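(* For every integer $t\ge2$ and every graph $G$ with adjacency matrix $A$, $$\hom(K_{t,t},G)\ge\|A\|_{q\to t}^{t^2},\qquad q:=\frac{t}{t-1}.$$ Consequently, if $M(G)>0$, then $$\hom(K_{t,t},G)\ge\frac{\lambda(G)^{2t(t-1)}}{M(G)^{t(t-2)}}.$$
   Context: Graphs are finite and simple. $\hom(H,G)$ is the number of homomorphisms from $H$ to $G$; $M(G):=2e(G)$ is twice the number of edges; $\lambda(G)$ is the spectral radius of the adjacency matrix. For a real $n\times n$ matrix $A$ and $1\le p,r\le\infty$, $\|A\|_{p\to r}:=\sup_{x\ne0}\|Ax\|_r/\|x\|_p$. *)

theory Defs
  imports
    "Graph_Theory.Kuratowski"
    "Jordan_Normal_Form.Spectral_Radius"
    "HOL-Library.Extended_Real"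
    "HOL-Library.FuncSet"
begin

text \<open>
  A finite simple graph is a \<open>pair_graph\<close>: a finite vertex set \<open>pverts G\<close> (possibly empty)
  with a symmetric loop-free set of ordered pairs \<open>parcs G\<close>. Every undirected edge is therefore
  represented by two arcs.
\<close>

definition edge_count :: "'a pair_pre_digraph \<Rightarrow> nat" where
  "edge_count G = card {{u, v} | u v. (u, v) \<in> parcs G}"

definition M :: "'a pair_pre_digraph \<Rightarrow> nat" where
  "M G = 2 * edge_count G"

text \<open>Homomorphisms are taken to be extensional, so that each vertex map is counted once.\<close>

definition homs :: "'b pair_pre_digraph \<Rightarrow> 'a pair_pre_digraph \<Rightarrow> ('b \<Rightarrow> 'a) set" where
  "homs H G = {f \<in> pverts H \<rightarrow>\<^sub>E pverts G. \<forall>(u, v) \<in> parcs H. (f u, f v) \<in> parcs G}"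

definition hom_count :: "'b pair_pre_digraph \<Rightarrow> 'a pair_pre_digraph \<Rightarrow> nat" where
  "hom_count H G = card (homs H G)"

text \<open>A graph has one adjacency matrix for each enumeration of its vertices.\<close>

definition is_adjacency_matrix :: "real mat \<Rightarrow> 'a pair_pre_digraph \<Rightarrow> bool" where
  "is_adjacency_matrix A G \<longleftrightarrow>
     (\<exists>vs. distinct vs \<and> set vs = pverts G \<and>
       A = mat (length vs) (length vs)
             (\<lambda>(i, j). if (vs ! i, vs ! j) \<in> parcs G then 1 else 0))"

definition real_spectral_radius :: "real mat \<Rightarrow> real" where
  "real_spectral_radius A = spectral_radius (map_mat complex_of_real A)"

text \<open>
  The \<open>\<ell>\<^sub>p\<close> norm for \<open>1 \<le> p \<le> \<infinity>\<close>. Note that \<open>0 powr a = 0\<close>; the inserted \<open>0\<close> matters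
  only for vectors of dimension zero.
\<close>

definition lp_norm :: "ereal \<Rightarrow> real vec \<Rightarrow> real" where
  "lp_norm p x =
     (if p = \<infinity> then Max (insert 0 {\<bar>x $ i\<bar> | i. i < dim_vec x})
      else (\<Sum>i<dim_vec x. \<bar>x $ i\<bar> powr real_of_ereal p) powr (1 / real_of_ereal p))"

text \<open>
  The quotients are nonnegative, so the inserted \<open>0\<close> matters only for matrices without columns
  (the empty graph), where there is no nonzero \<open>x\<close> and the norm is \<open>0\<close>.
\<close>

definition op_norm :: "ereal \<Rightarrow> ereal \<Rightarrow> real mat \<Rightarrow> real" where
  "op_norm p r A =
     Sup (insert 0 {lp_norm r (A *\<^sub>v x) / lp_norm p x | x.
       x \<in> carrier_vec (dim_col A) \<and> x \<noteq> 0\<^sub>v (dim_col A)})"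

end

theory Submission
  imports Defs "HOL-Analysis.Convex"
begin

text \<open>
  Let \<open>U\<close> be one side of \<open>K\<^bsub>t,t\<^esub>\<close>. Grouping homomorphisms by their restriction \<open>g\<close> to \<open>U\<close> gives
  \<open>hom(K\<^bsub>t,t\<^esub>, G) = (\<Sum>g. N(g) ^ t)\<close>, where \<open>N(g)\<close> is the number of common neighbours of the values
  of \<open>g\<close>. For \<open>x \<ge> 0\<close>, expanding the \<open>t\<close>-th powers in \<open>\<parallel>A x\<parallel>\<^sub>t ^ t\<close> yields \<open>\<Sum>g. N(g) * (\<Prod>k\<in>U. x (g k))\<close>,
  and the Hoelder inequality with exponents \<open>t\<close> and \<open>q\<close> bounds this by
  \<open>hom(K\<^bsub>t,t\<^esub>, G) powr (1/t) * \<parallel>x\<parallel>\<^sub>q ^ t\<close>.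
\<close>

section \<open>Hoelder and power mean inequalities for finite sums\<close>

text \<open>Normalise both sequences to unit norm, apply Young's inequality to each product and sum;
  the bounds add up to \<open>1/p + 1/q = 1\<close>.\<close>

lemma Holder_inequality_sum:
  fixes f g :: "'i \<Rightarrow> real" and p q :: real
  assumes fin: "finite I" and pq: "p > 1" "q > 1" "1/p + 1/q = 1"
    and f: "\<And>i. i \<in> I \<Longrightarrow> f i \<ge> 0" and g: "\<And>i. i \<in> I \<Longrightarrow> g i \<ge> 0"
  shows "(\<Sum>i\<in>I. f i * g i) \<le> (\<Sum>i\<in>I. f i powr p) powr (1/p) * (\<Sum>i\<in>I. g i powr q) powr (1/q)"
proof -
  define S where "S = (\<Sum>i\<in>I. f i powr p)"
  define T where "T = (\<Sum>i\<in>I. g i powr q)"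
  have nn: "S \<ge> 0" "T \<ge> 0"
    by (auto simp: S_def T_def intro: sum_nonneg)
  show ?thesis
  proof (cases "S = 0 \<or> T = 0")
    \<comment> \<open>A zero norm cannot be normalised, but it forces every product to
      vanish.\<close>
    case True
    then have "\<forall>i\<in>I. f i * g i = 0"
      using fin by (auto simp: S_def T_def sum_nonneg_eq_0_iff)
    then have "(\<Sum>i\<in>I. f i * g i) = 0"
      by simp
    then show ?thesis
      by simp
  next
    case False
    define a where "a = S powr (1/p)"
    define b where "b = T powr (1/q)"
    have pos: "a > 0" "b > 0" and pw: "a powr p = S" "b powr q = T" and "S > 0" "T > 0"
      using False nn pq by (auto simp: a_def b_def powr_powr)
    have "(\<Sum>i\<in>I. f i / a * (g i / b)) \<le> (\<Sum>i\<in>I. (f i / a) powr p / p + (g i / b) powr q / q)"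
      using f g pos pq by (intro sum_mono Youngs_inequality) auto
    also have "\<dots> = (\<Sum>i\<in>I. f i powr p / S / p + g i powr q / T / q)"
      using f g pos pw by (intro sum.cong refl) (simp add: powr_divide)
    also have "\<dots> = S / S / p + T / T / q"
      by (simp only: sum.distrib S_def T_def flip: sum_divide_distrib)
    also have "\<dots> = 1"
      using \<open>S > 0\<close> \<open>T > 0\<close> pq by simp
    finally have "(\<Sum>i\<in>I. f i * g i) / (a * b) \<le> 1"
      by (simp add: sum_divide_distrib)
    then show ?thesis
      using pos by (simp add: divide_le_eq a_def b_def S_def T_def)
  qed
qed

text \<open>Power mean inequality: Hoelder against the constant 1, with exponents
  \<open>\<alpha> / (\<alpha> - 1)\<close> and \<open>\<alpha>\<close>.\<close>

lemma sum_powr_le_card_powr: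
  fixes z :: "'i \<Rightarrow> real"
  assumes fin: "finite I" and "\<alpha> \<ge> 1" and z: "\<And>i. i \<in> I \<Longrightarrow> z i \<ge> 0"
  shows "(\<Sum>i\<in>I. z i) powr \<alpha> \<le> real (card I) powr (\<alpha> - 1) * (\<Sum>i\<in>I. z i powr \<alpha>)"
proof (cases "\<alpha> = 1 \<or> I = {}")
  \<comment> \<open>At \<open>\<alpha> = 1\<close> the conjugate exponent degenerates. There
    \<open>real (card I) powr 0\<close> is 1 for nonempty \<open>I\<close>; for empty
    \<open>I\<close> both sides vanish.\<close>
  case True
  then show ?thesis
    using fin z by (cases "I = {}") (auto simp: sum_nonneg)
next
  case False
  define \<beta> where "\<beta> = \<alpha> / (\<alpha> - 1)"
  have \<alpha>: "\<alpha> > 1" "card I > 0"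
    using False fin assms(2) by (auto simp: card_gt_0_iff)
  then have \<beta>: "\<beta> > 1" "1/\<beta> + 1/\<alpha> = 1" "\<alpha> / \<beta> = \<alpha> - 1"
    by (auto simp: \<beta>_def field_simps)
  have "(\<Sum>i\<in>I. 1 * z i) \<le> (\<Sum>i\<in>I. 1 powr \<beta>) powr (1/\<beta>) * (\<Sum>i\<in>I. z i powr \<alpha>) powr (1/\<alpha>)"
    using fin \<alpha> \<beta> z by (intro Holder_inequality_sum) auto
  then have "(\<Sum>i\<in>I. z i) powr \<alpha> \<le>
      (real (card I) powr (1/\<beta>) * (\<Sum>i\<in>I. z i powr \<alpha>) powr (1/\<alpha>)) powr \<alpha>"
    using z \<alpha> by (intro powr_mono2) (auto intro: sum_nonneg)
  also have "\<dots> = real (card I) powr (\<alpha> - 1) * (\<Sum>i\<in>I. z i powr \<alpha>)"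
    using \<alpha> \<beta> by (simp add: powr_mult powr_powr sum_nonneg)
  finally show ?thesis .
qed

section \<open>Powers of neighbourhood sums and the quadratic form of a graph\<close>

text \<open>Write the power as a product over \<open>U\<close> of equal sums and distribute:
  choosing one neighbour of \<open>v\<close> per factor is a map \<open>g\<close>, and each
  \<open>g\<close> arises once for every \<open>v\<close> adjacent to all its values.\<close>

lemma sum_neighbours_power:
  fixes x :: "'a \<Rightarrow> real"
  assumes V: "finite V" and U: "finite U"
  shows "(\<Sum>v\<in>V. (\<Sum>u\<in>{u\<in>V. (v, u) \<in> E}. x u) ^ card U) =
    (\<Sum>g\<in>U \<rightarrow>\<^sub>E V. real (card {v\<in>V. \<forall>k\<in>U. (v, g k) \<in> E}) * (\<Prod>k\<in>U. x (g k)))"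
proof -
  \<comment> \<open>Terms outside the neighbourhood become 0, so that the index set of maps does not
    depend on \<open>v\<close> and the sums can be swapped.\<close>
  have "(\<Sum>v\<in>V. (\<Sum>u\<in>{u\<in>V. (v, u) \<in> E}. x u) ^ card U) =
      (\<Sum>v\<in>V. \<Prod>k\<in>U. \<Sum>u\<in>V. if (v, u) \<in> E then x u else 0)"
    using V by (simp add: sum.inter_filter)
  also have "\<dots> = (\<Sum>v\<in>V. \<Sum>g\<in>U \<rightarrow>\<^sub>E V. \<Prod>k\<in>U. if (v, g k) \<in> E then x (g k) else 0)"
    using V U by (simp only: prod_sum_PiE)
  also have "\<dots> = (\<Sum>v\<in>V. \<Sum>g\<in>U \<rightarrow>\<^sub>E V. if \<forall>k\<in>U. (v, g k) \<in> E then \<Prod>k\<in>U. x (g k) else 0)"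
    using U by (intro sum.cong refl) auto
  also have "\<dots> = (\<Sum>g\<in>U \<rightarrow>\<^sub>E V. \<Sum>v\<in>V. if \<forall>k\<in>U. (v, g k) \<in> E then \<Prod>k\<in>U. x (g k) else 0)"
    by (rule sum.swap)
  also have "\<dots> = (\<Sum>g\<in>U \<rightarrow>\<^sub>E V. real (card {v\<in>V. \<forall>k\<in>U. (v, g k) \<in> E}) * (\<Prod>k\<in>U. x (g k)))"
    using V by (simp flip: sum.inter_filter)
  finally show ?thesis .
qed

text \<open>Hoelder over the maps \<open>g\<close> separates the common-neighbour counts from the
  weights. \<open>C\<close> is the homomorphism count once \<open>U\<close> is one side of the
  complete bipartite graph.\<close>

lemma sum_neighbours_power_le:
  fixes x :: "'a \<Rightarrow> real" and E :: "('a \<times> 'a) set" and U :: "'b set" and q :: real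
  assumes V: "finite V" and U: "card U = t" "t \<ge> 2" and q: "q = real t / (real t - 1)"
    and x: "\<And>v. v \<in> V \<Longrightarrow> x v \<ge> 0"
  defines "C \<equiv> \<Sum>g\<in>U \<rightarrow>\<^sub>E V. card {v\<in>V. \<forall>k\<in>U. (v, g k) \<in> E} ^ t"
  shows "(\<Sum>v\<in>V. (\<Sum>u\<in>{u\<in>V. (v, u) \<in> E}. x u) ^ t) powr (1 / real t) \<le>
    real C powr (1 / real (t\<^sup>2)) * (\<Sum>v\<in>V. x v powr q) powr (1 / q)"
proof -
  have finU: "finite U"
    using U card.infinite by fastforce
  have t: "real t > 1" and q1: "q > 1" and conj: "1 / real t + 1 / q = 1"
    using U by (auto simp: q field_simps)
  have fin: "finite (U \<rightarrow>\<^sub>E V)"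
    using V finU by (simp add: finite_PiE)
  define S where "S = (\<Sum>v\<in>V. x v powr q)"
  have S: "S \<ge> 0"
    by (simp add: S_def sum_nonneg)
  have nn: "(\<Prod>k\<in>U. x (g k)) \<ge> 0" if "g \<in> U \<rightarrow>\<^sub>E V" for g
    using that x by (intro prod_nonneg) (auto simp: PiE_iff)
  \<comment> \<open>The weights are products over \<open>U\<close>, so their sum over all maps
    factorises into \<open>t\<close> copies of \<open>S\<close>.\<close>
  have "(\<Sum>g\<in>U \<rightarrow>\<^sub>E V. (\<Prod>k\<in>U. x (g k)) powr q) = (\<Sum>g\<in>U \<rightarrow>\<^sub>E V. \<Prod>k\<in>U. x (g k) powr q)"
    using x by (intro sum.cong refl) (auto simp: PiE_iff intro!: prod_powr_distrib)
  also have "\<dots> = (\<Prod>k\<in>U. \<Sum>v\<in>V. x v powr q)"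
    using V finU by (simp only: prod_sum_PiE)
  also have "\<dots> = S ^ t"
    by (simp add: S_def U)
  finally have S_t: "(\<Sum>g\<in>U \<rightarrow>\<^sub>E V. (\<Prod>k\<in>U. x (g k)) powr q) = S ^ t" .
  have "(\<Sum>v\<in>V. (\<Sum>u\<in>{u\<in>V. (v, u) \<in> E}. x u) ^ t) =
      (\<Sum>g\<in>U \<rightarrow>\<^sub>E V. real (card {v\<in>V. \<forall>k\<in>U. (v, g k) \<in> E}) * (\<Prod>k\<in>U. x (g k)))"
    using sum_neighbours_power[OF V finU, where E = E and x = x] U by simp
  also have "\<dots> \<le> (\<Sum>g\<in>U \<rightarrow>\<^sub>E V. real (card {v\<in>V. \<forall>k\<in>U. (v, g k) \<in> E}) powr real t) powr (1 / real t)
      * (\<Sum>g\<in>U \<rightarrow>\<^sub>E V. (\<Prod>k\<in>U. x (g k)) powr q) powr (1 / q)"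
    using fin t q1 conj nn by (intro Holder_inequality_sum) auto
  also have "\<dots> = real C powr (1 / real t) * (S ^ t) powr (1 / q)"
    using t by (simp add: S_t C_def powr_realpow')
  finally have "(\<Sum>v\<in>V. (\<Sum>u\<in>{u\<in>V. (v, u) \<in> E}. x u) ^ t) powr (1 / real t) \<le>
      (real C powr (1 / real t) * (S ^ t) powr (1 / q)) powr (1 / real t)"
    using x t by (intro powr_mono2) (auto intro!: sum_nonneg zero_le_power)
  \<comment> \<open>The outer root \<open>1/t\<close> turns \<open>1/t\<close> into
    \<open>1/t\<^sup>2\<close> on \<open>C\<close> and cancels the \<open>t\<close>-th power of
    \<open>S\<close>.\<close>
  also have "\<dots> = real C powr (1 / real (t\<^sup>2)) * S powr (1 / q)"
    using S t by (simp add: powr_mult powr_powr power2_eq_square flip: powr_realpow')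
  finally show ?thesis
    by (simp add: S_def)
qed

text \<open>Hoelder pairs the \<open>q\<close>-norm of \<open>x\<close> with the
  \<open>t\<close>-norm of its neighbourhood sums; bounding the latter brings in the
  \<open>q\<close>-norm of \<open>x\<close> a second time.\<close>

lemma bilinear_form_le:
  fixes x :: "'a \<Rightarrow> real" and E :: "('a \<times> 'a) set" and U :: "'b set" and q :: real
  assumes V: "finite V" and U: "card U = t" "t \<ge> 2" and q: "q = real t / (real t - 1)"
    and x: "\<And>v. v \<in> V \<Longrightarrow> x v \<ge> 0"
  defines "C \<equiv> \<Sum>g\<in>U \<rightarrow>\<^sub>E V. card {v\<in>V. \<forall>k\<in>U. (v, g k) \<in> E} ^ t"
  shows "(\<Sum>v\<in>V. x v * (\<Sum>u\<in>{u\<in>V. (v, u) \<in> E}. x u)) \<le>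
    real C powr (1 / real (t\<^sup>2)) * (\<Sum>v\<in>V. x v powr q) powr (2 / q)"
proof -
  have t: "real t > 1" and q1: "q > 1" and conj: "1 / q + 1 / real t = 1"
    using U by (auto simp: q field_simps)
  have pow: "(\<Sum>u\<in>{u\<in>V. (v, u) \<in> E}. x u) powr real t = (\<Sum>u\<in>{u\<in>V. (v, u) \<in> E}. x u) ^ t" for v
    using x t by (intro powr_realpow' sum_nonneg) auto
  let ?S = "\<Sum>v\<in>V. x v powr q"
  have "(\<Sum>v\<in>V. x v * (\<Sum>u\<in>{u\<in>V. (v, u) \<in> E}. x u)) \<le>
      ?S powr (1 / q) * (\<Sum>v\<in>V. (\<Sum>u\<in>{u\<in>V. (v, u) \<in> E}. x u) powr real t) powr (1 / real t)"
    using V t q1 conj x by (intro Holder_inequality_sum) (auto intro: sum_nonneg)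
  also have "\<dots> = ?S powr (1 / q) * (\<Sum>v\<in>V. (\<Sum>u\<in>{u\<in>V. (v, u) \<in> E}. x u) ^ t) powr (1 / real t)"
    by (simp only: pow)
  also have "\<dots> \<le> ?S powr (1 / q) * (real C powr (1 / real (t\<^sup>2)) * ?S powr (1 / q))"
    unfolding C_def using sum_neighbours_power_le[OF V U q x] by (intro mult_left_mono) auto
  also have "\<dots> = real C powr (1 / real (t\<^sup>2)) * ?S powr (2 / q)"
    by (simp flip: powr_add)
  finally show ?thesis .
qed

text \<open>
  For nonnegative matrices this replaces Riesz--Thorin interpolation of the \<open>2 \<rightarrow> 2\<close> norm between
  the \<open>q \<rightarrow> t\<close> and the \<open>\<infinity> \<rightarrow> 1\<close> norm: apply the power mean inequality to the edge weights
  \<open>x v * x u\<close> with exponent \<open>2 / q\<close>.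
\<close>

lemma quadratic_form_power_le:
  fixes x :: "'a \<Rightarrow> real" and E :: "('a \<times> 'a) set" and U :: "'b set"
  assumes V: "finite V" and E: "E \<subseteq> V \<times> V" and U: "card U = t" "t \<ge> 2"
    and x: "\<And>v. v \<in> V \<Longrightarrow> x v \<ge> 0" and norm1: "(\<Sum>v\<in>V. (x v)\<^sup>2) = 1"
  defines "C \<equiv> \<Sum>g\<in>U \<rightarrow>\<^sub>E V. card {v\<in>V. \<forall>k\<in>U. (v, g k) \<in> E} ^ t"
  shows "(\<Sum>v\<in>V. x v * (\<Sum>u\<in>{u\<in>V. (v, u) \<in> E}. x u)) ^ (2 * t * (t - 1)) \<le>
    real (card E) ^ (t * (t - 2)) * real C"
proof -
  define q where "q = real t / (real t - 1)"
  \<comment> \<open>This exponent gives \<open>\<alpha> * q = 2\<close>, so that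
    \<open>norm1\<close> controls the \<open>q\<close>-norm of \<open>x powr \<alpha>\<close>. It is
    at least 1 because \<open>t \<ge> 2\<close>, and multiplying by \<open>t\<^sup>2\<close> clears
    denominators.\<close>
  define \<alpha> where "\<alpha> = 2 / q"
  have t: "real t > 1" and q1: "q > 1"
    using U by (auto simp: q_def field_simps)
  have \<alpha>: "\<alpha> \<ge> 1" "\<alpha> * q = 2" "\<alpha> * real (t\<^sup>2) = real (2 * t * (t - 1))"
      "(\<alpha> - 1) * real (t\<^sup>2) = real (t * (t - 2))"
    using U by (auto simp: \<alpha>_def q_def field_simps of_nat_diff power2_eq_square)
  have finE: "finite E"
    using V E finite_subset by blast
  have xE: "x (fst e) \<ge> 0" "x (snd e) \<ge> 0" if "e \<in> E" for e
    using that E x by auto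
  \<comment> \<open>Stated for every \<open>y\<close>, since it serves both \<open>x\<close> and its
    power: on the sum over arcs the power acts term by term.\<close>
  have form: "(\<Sum>v\<in>V. y v * (\<Sum>u\<in>{u\<in>V. (v, u) \<in> E}. y u)) = (\<Sum>e\<in>E. y (fst e) * y (snd e))"
    for y :: "'a \<Rightarrow> real"
  proof -
    have "(\<Sum>v\<in>V. y v * (\<Sum>u\<in>{u\<in>V. (v, u) \<in> E}. y u)) =
        (\<Sum>e\<in>(SIGMA v:V. {u\<in>V. (v, u) \<in> E}). y (fst e) * y (snd e))"
      using V by (simp add: sum_distrib_left sum.Sigma case_prod_beta)
    also have "(SIGMA v:V. {u\<in>V. (v, u) \<in> E}) = E"
      using E by auto
    finally show ?thesis .
  qed
  let ?Q = "\<Sum>v\<in>V. x v * (\<Sum>u\<in>{u\<in>V. (v, u) \<in> E}. x u)"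
  let ?y = "\<lambda>v. x v powr \<alpha>"
  have Q: "?Q \<ge> 0"
    using x by (auto intro!: sum_nonneg mult_nonneg_nonneg)
  have "?Q powr \<alpha> \<le> real (card E) powr (\<alpha> - 1) * (\<Sum>e\<in>E. (x (fst e) * x (snd e)) powr \<alpha>)"
    unfolding form using finE \<alpha> xE by (intro sum_powr_le_card_powr) auto
  also have "(\<Sum>e\<in>E. (x (fst e) * x (snd e)) powr \<alpha>) = (\<Sum>e\<in>E. ?y (fst e) * ?y (snd e))"
    using xE by (simp add: powr_mult)
  also have "\<dots> \<le> real C powr (1 / real (t\<^sup>2)) * (\<Sum>v\<in>V. ?y v powr q) powr (2 / q)"
    unfolding C_def form[of ?y, symmetric] using bilinear_form_le[OF V U q_def, where E = E and x = ?y] by simp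
  also have "(\<Sum>v\<in>V. ?y v powr q) = 1"
    using x \<alpha> norm1 by (simp add: powr_powr)
  finally have "?Q powr \<alpha> \<le> real (card E) powr (\<alpha> - 1) * real C powr (1 / real (t\<^sup>2))"
    by (simp add: mult_left_mono)
  then have "(?Q powr \<alpha>) powr real (t\<^sup>2) \<le>
      (real (card E) powr (\<alpha> - 1) * real C powr (1 / real (t\<^sup>2))) powr real (t\<^sup>2)"
    by (intro powr_mono2) auto
  also have "\<dots> = real (card E) powr real (t * (t - 2)) * real C"
    using t \<alpha>(4) by (simp add: powr_mult powr_powr)
  also have "(?Q powr \<alpha>) powr real (t\<^sup>2) = ?Q ^ (2 * t * (t - 1))"
    unfolding powr_powr \<alpha>(3) using Q U by (intro powr_realpow') auto
  \<comment> \<open>Only an inequality: for \<open>t = 2\<close> and no arcs,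
    \<open>0 powr 0 = 0\<close> but \<open>0 ^ 0 = 1\<close>.\<close>
  also have "real (card E) powr real (t * (t - 2)) \<le> real (card E) ^ (t * (t - 2))"
    by (cases "card E = 0") (auto simp: powr_realpow simp del: of_nat_mult)
  finally show ?thesis
    by (simp add: mult_right_mono)
qed

section \<open>Counting homomorphisms and arcs\<close>

text \<open>Once the restriction \<open>g\<close> to \<open>U\<close> is fixed, the vertices of
  \<open>W\<close> go independently to common neighbours of the values of \<open>g\<close>.\<close>

lemma hom_count_complete_bipartite:
  fixes G :: "'a pair_pre_digraph" and K :: "'b pair_pre_digraph"
  assumes G: "pair_graph G"
    and K: "finite (pverts K)" "pverts K = U \<union> W" "U \<inter> W = {}" "parcs K = U \<times> W \<union> W \<times> U"
  shows "hom_count K G =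
    (\<Sum>g\<in>U \<rightarrow>\<^sub>E pverts G. card {v\<in>pverts G. \<forall>k\<in>U. (v, g k) \<in> parcs G} ^ card W)"
proof -
  interpret pair_graph G by fact
  let ?V = "pverts G"
  let ?N = "\<lambda>g. {v\<in>?V. \<forall>k\<in>U. (v, g k) \<in> parcs G}"
  have fin: "finite U" "finite W" "finite ?V"
    using K pair_finite_verts by auto
  \<comment> \<open>\<open>parcs K\<close> has both orientations, while the fibre over
    \<open>g\<close> records only arcs from images of \<open>W\<close> to images of
    \<open>U\<close>; symmetry restores the others.\<close>
  have sym: "(v, u) \<in> parcs G" if "(u, v) \<in> parcs G" for u v
    using that sym_arcs by (auto simp: symmetric_def elim: symE)
  have "bij_betw (\<lambda>f. (restrict f U, restrict f W)) (homs K G)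
      (SIGMA g:(U \<rightarrow>\<^sub>E ?V). (W \<rightarrow>\<^sub>E ?N g))"
  proof (rule bij_betw_byWitness[where f' = "\<lambda>(g, h) x. if x \<in> U then g x else h x"])
    show "\<forall>f\<in>homs K G. (case (restrict f U, restrict f W) of
        (g, h) \<Rightarrow> \<lambda>x. if x \<in> U then g x else h x) = f"
      using K by (auto simp: homs_def fun_eq_iff PiE_iff extensional_def)
    show "\<forall>p\<in>(SIGMA g:(U \<rightarrow>\<^sub>E ?V). (W \<rightarrow>\<^sub>E ?N g)).
        (\<lambda>f. (restrict f U, restrict f W)) (case p of
          (g, h) \<Rightarrow> \<lambda>x. if x \<in> U then g x else h x) = p"
      using K by (auto simp: fun_eq_iff PiE_iff extensional_def)
    show "(\<lambda>f. (restrict f U, restrict f W)) ` homs K G \<subseteq> (SIGMA g:(U \<rightarrow>\<^sub>E ?V). (W \<rightarrow>\<^sub>E ?N g))"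
      using K sym by (auto simp: homs_def PiE_iff ball_Un split_paired_Ball_Sigma)
    show "(\<lambda>(g, h) x. if x \<in> U then g x else h x) ` (SIGMA g:(U \<rightarrow>\<^sub>E ?V). (W \<rightarrow>\<^sub>E ?N g)) \<subseteq> homs K G"
      using K sym
      by (auto simp: homs_def PiE_iff extensional_def ball_Un split_paired_Ball_Sigma disjoint_iff)
  qed
  then have "hom_count K G = card (SIGMA g:(U \<rightarrow>\<^sub>E ?V). (W \<rightarrow>\<^sub>E ?N g))"
    unfolding hom_count_def by (rule bij_betw_same_card)
  also have "\<dots> = (\<Sum>g\<in>U \<rightarrow>\<^sub>E ?V. card (?N g) ^ card W)"
    using fin by (simp add: finite_PiE card_funcsetE)
  finally show ?thesis .
qed

text \<open>Group the arcs by underlying edge: symmetry supplies both orientations, and the absence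
  of loops makes them distinct.\<close>

lemma M_eq_card_parcs:
  assumes "pair_graph G"
  shows "M G = card (parcs G)"
proof -
  interpret pair_graph G by fact
  have sym: "(v, u) \<in> parcs G" if "(u, v) \<in> parcs G" for u v
    using that sym_arcs by (auto simp: symmetric_def elim: symE)
  let ?fibre = "\<lambda>e. {(u, v) \<in> parcs G. {u, v} = e}"
  let ?edges = "{{u, v} | u v. (u, v) \<in> parcs G}"
  have edges: "?edges = (\<lambda>(u, v). {u, v}) ` parcs G"
    by auto
  have fin: "finite ?edges"
    unfolding edges using pair_finite_arcs by simp
  have fibre: "card (?fibre e) = 2" if e: "e \<in> ?edges" for e
  proof -
    obtain u v where uv: "e = {u, v}" "(u, v) \<in> parcs G"
      using e by auto
    have "u \<noteq> v"
      using pair_no_loops[OF uv(2)] by simp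
    moreover have "?fibre e = {(u, v), (v, u)}"
      using uv sym by (auto simp: doubleton_eq_iff)
    ultimately show ?thesis
      by simp
  qed
  have "card (parcs G) = (\<Sum>e\<in>?edges. card {p \<in> parcs G. (\<lambda>(u, v). {u, v}) p = e})"
    using sum.group[OF pair_finite_arcs fin, of "\<lambda>(u, v). {u, v}" "\<lambda>_. 1::nat"] edges by simp
  also have "\<dots> = (\<Sum>e\<in>?edges. card (?fibre e))"
    by (intro sum.cong refl arg_cong[where f = card]) auto
  also have "\<dots> = M G"
    using fibre by (simp add: M_def edge_count_def)
  finally show ?thesis ..
qed

section \<open>From vectors indexed by positions to functions on vertices\<close>

lemma sum_set_conv_nth:
  assumes "distinct vs"
  shows "(\<Sum>u\<in>set vs. h u) = (\<Sum>j<length vs. h (vs ! j))"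
  by (rule sum.reindex_bij_betw[OF bij_betw_nth, symmetric]) (use assms in auto)

text \<open>Moves vector entries to the vertices; distinctness makes the position of a vertex
  unique.\<close>

lemma ex_fun_nth:
  assumes "distinct vs"
  obtains X where "\<And>j. j < length vs \<Longrightarrow> X (vs ! j) = f j"
proof
  fix j assume "j < length vs"
  then show "(\<lambda>u. f (THE j. j < length vs \<and> vs ! j = u)) (vs ! j) = f j"
    using assms by (auto simp: nth_eq_iff_index_eq intro!: arg_cong[where f = f] the_equality)
qed

text \<open>Triangle inequality with 0/1 entries. The field is general so as to cover real vectors
  for the operator norm and complex eigenvectors for the spectral radius.\<close>

lemma norm_adjacency_mult_vec_le:
  fixes x :: "'c::real_normed_field vec" and vs :: "'a list" and E :: "('a \<times> 'a) set"
  assumes vs: "distinct vs" and x: "x \<in> carrier_vec (length vs)"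
    and X: "\<And>j. j < length vs \<Longrightarrow> X (vs ! j) = norm (x $ j)" and i: "i < length vs"
  defines "A \<equiv> mat (length vs) (length vs) (\<lambda>(i, j). if (vs ! i, vs ! j) \<in> E then 1 else 0)"
  shows "norm ((A *\<^sub>v x) $ i) \<le> (\<Sum>u\<in>{u\<in>set vs. (vs ! i, u) \<in> E}. X u)"
proof -
  have "(A *\<^sub>v x) $ i = (\<Sum>j<length vs. if (vs ! i, vs ! j) \<in> E then x $ j else 0)"
    using i x by (auto simp: A_def scalar_prod_def lessThan_atLeast0 intro!: sum.cong)
  then have "norm ((A *\<^sub>v x) $ i) \<le> (\<Sum>j<length vs. norm (if (vs ! i, vs ! j) \<in> E then x $ j else 0))"
    by (simp only: norm_sum)
  also have "\<dots> = (\<Sum>j<length vs. if (vs ! i, vs ! j) \<in> E then X (vs ! j) else 0)"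
    using X by (intro sum.cong) auto
  also have "\<dots> = (\<Sum>u\<in>{u\<in>set vs. (vs ! i, u) \<in> E}. X u)"
    by (simp add: sum.inter_filter sum_set_conv_nth[OF vs])
  finally show ?thesis .
qed

section \<open>Operator norm and spectral radius\<close>

theorem lemma2p4:
  fixes t :: nat
    and G :: "'a pair_pre_digraph"
    and A :: "real mat"
    and K :: "'b pair_pre_digraph"
    and q :: real
  assumes "t \<ge> 2"
    and "pair_graph G"
    and "is_adjacency_matrix A G"
    and "K\<^bsub>t,t\<^esub> (with_proj K)"
    and "q = real t / (real t - 1)"
  shows "real (hom_count K G) \<ge> op_norm (ereal q) (ereal (real t)) A ^ (t ^ 2) \<and>
    (M G > 0 \<longrightarrow>
      real (hom_count K G) \<ge>
        real_spectral_radius A ^ (2 * t * (t - 1)) / real (M G) ^ (t * (t - 2)))"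
proof -
  interpret pair_graph G by fact
  let ?V = "pverts G" and ?E = "parcs G"
  have E: "?E \<subseteq> ?V \<times> ?V"
    by (auto dest: wellformed)
  obtain vs where vs: "distinct vs" "set vs = ?V"
    and A: "A = mat (length vs) (length vs) (\<lambda>(i, j). if (vs ! i, vs ! j) \<in> ?E then 1 else 0)"
    using assms(3) by (auto simp: is_adjacency_matrix_def)
  define n where "n = length vs"
  obtain U W where K: "finite (pverts K)" "pverts K = U \<union> W" "U \<inter> W = {}"
      "parcs K = U \<times> W \<union> W \<times> U" and card: "card U = t" "card W = t"
    using assms(4) unfolding complete_bipartite_digraph_pair_def by blast
  define C where "C = hom_count K G"
  have C: "C = (\<Sum>g\<in>U \<rightarrow>\<^sub>E ?V. card {v\<in>?V. \<forall>k\<in>U. (v, g k) \<in> ?E} ^ t)"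
    using hom_count_complete_bipartite[OF assms(2) K] card by (simp add: C_def)
  define c where "c = real C powr (1 / real (t\<^sup>2))"
  have t: "t > 0" "q > 1"
    using assms(1) by (auto simp: assms(5) field_simps)
  have c: "c \<ge> 0" "c ^ (t\<^sup>2) = real C"
  proof -
    show "c \<ge> 0"
      by (simp add: c_def)
    then have "c ^ (t\<^sup>2) = c powr real (t\<^sup>2)"
      using t by (intro powr_realpow'[symmetric]) auto
    also have "\<dots> = real C"
      using t by (simp add: c_def powr_powr)
    finally show "c ^ (t\<^sup>2) = real C" .
  qed
  have dim: "dim_row A = n" "dim_col A = n"
    unfolding A n_def by simp_all

  have ratio: "0 \<le> lp_norm t (A *\<^sub>v x) / lp_norm q x \<and> lp_norm t (A *\<^sub>v x) / lp_norm q x \<le> c"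
    if x: "x \<in> carrier_vec n" for x :: "real vec"
  proof -
    \<comment> \<open>Taking absolute values keeps the \<open>q\<close>-norm of \<open>x\<close> and
      can only increase that of its image, so the bound for nonnegative functions applies.\<close>
    obtain X where X: "\<And>j. j < length vs \<Longrightarrow> X (vs ! j) = norm (x $ j)"
      using ex_fun_nth[OF vs(1), where f = "\<lambda>j. norm (x $ j)"] by blast
    have X0: "X v \<ge> 0" if "v \<in> ?V" for v
      using that X vs(2) by (metis in_set_conv_nth norm_ge_zero)
    have "lp_norm t (A *\<^sub>v x) = (\<Sum>i<n. \<bar>(A *\<^sub>v x) $ i\<bar> ^ t) powr (1 / real t)"
      using t dim by (simp add: lp_norm_def powr_realpow')
    also have "\<dots> \<le> (\<Sum>i<n. (\<Sum>u\<in>{u\<in>?V. (vs ! i, u) \<in> ?E}. X u) ^ t) powr (1 / real t)"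
      using norm_adjacency_mult_vec_le[OF vs(1), of x X _ ?E] x X vs(2)
      by (intro powr_mono2 sum_mono power_mono) (auto simp: n_def A intro: sum_nonneg)
    also have "\<dots> = (\<Sum>v\<in>?V. (\<Sum>u\<in>{u\<in>?V. (v, u) \<in> ?E}. X u) ^ t) powr (1 / real t)"
      by (simp add: sum_set_conv_nth[OF vs(1)] n_def flip: vs(2))
    also have "\<dots> \<le> c * (\<Sum>v\<in>?V. X v powr q) powr (1 / q)"
      unfolding c_def C
      by (rule sum_neighbours_power_le[OF pair_finite_verts card(1) assms(1,5) X0])
    also have "(\<Sum>v\<in>?V. X v powr q) powr (1 / q) = lp_norm q x"
      using x X by (simp add: lp_norm_def sum_set_conv_nth[OF vs(1)] n_def flip: vs(2))
    finally have "lp_norm t (A *\<^sub>v x) \<le> c * lp_norm q x" .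
    moreover have "lp_norm t (A *\<^sub>v x) \<ge> 0" "lp_norm q x \<ge> 0"
      by (simp_all add: lp_norm_def)
    \<comment> \<open>If \<open>lp_norm q x = 0\<close>, the quotient is 0 by convention.\<close>
    ultimately show ?thesis
      using c by (auto simp: divide_le_eq)
  qed
  \<comment> \<open>The uniform bound \<open>c\<close> makes the set bounded above, so its member 0
    lies below the supremum; nonnegativity is what allows taking powers.\<close>
  have "0 \<le> op_norm q t A \<and> op_norm q t A \<le> c"
    unfolding op_norm_def dim using ratio c
    by (intro conjI cSup_upper cSup_least bdd_aboveI[where M = c]) auto
  then have "op_norm q t A ^ (t\<^sup>2) \<le> real C"
    using power_mono c(2) by metis

  moreover have "real_spectral_radius A ^ (2 * t * (t - 1)) / real (M G) ^ (t * (t - 2)) \<le> real C"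
    if M: "M G > 0"
  proof -
    define B where "B = map_mat complex_of_real A"
    have B: "B \<in> carrier_mat n n" and B_eq: "B =
        mat (length vs) (length vs) (\<lambda>(i, j). if (vs ! i, vs ! j) \<in> ?E then 1 else 0)"
      by (auto simp: B_def A n_def)
    \<comment> \<open>An arc forces positive dimension, where the spectral radius is attained by an
      eigenvalue.\<close>
    have "?E \<noteq> {}"
      using M by (auto simp: M_eq_card_parcs[OF assms(2)])
    then have "n > 0"
      using vs E by (auto simp: n_def)
    then obtain \<mu> where \<mu>: "eigenvalue B \<mu>" "spectral_radius B = norm \<mu>"
      using spectral_radius_mem_max(1)[OF B] by (auto simp: spectrum_def)
    then obtain z where z: "z \<in> carrier_vec n" "z \<noteq> 0\<^sub>v n" "B *\<^sub>v z = \<mu> \<cdot>\<^sub>v z"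
      using B by (auto simp: eigenvalue_def eigenvector_def)
    obtain Z where Z: "\<And>j. j < length vs \<Longrightarrow> Z (vs ! j) = norm (z $ j)"
      using ex_fun_nth[OF vs(1), where f = "\<lambda>j. norm (z $ j)"] by blast
    have Z0: "Z v \<ge> 0" if "v \<in> ?V" for v
      using that Z vs(2) by (metis in_set_conv_nth norm_ge_zero)
    \<comment> \<open>The moduli of the complex eigenvector, scaled by \<open>s\<close> to unit
      Euclidean norm, give the nonnegative test function \<open>x\<close>.\<close>
    define s where "s = sqrt (\<Sum>v\<in>?V. (Z v)\<^sup>2)"
    define x where "x v = Z v / s" for v
    have "\<exists>i<n. z $ i \<noteq> 0"
      using z by (metis carrier_vecD eq_vecI index_zero_vec)
    then obtain v where "v \<in> ?V" "Z v \<noteq> 0"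
      using Z vs(2) by (metis n_def norm_eq_zero nth_mem)
    then have "(\<Sum>v\<in>?V. (Z v)\<^sup>2) > 0"
      using pair_finite_verts by (intro sum_pos2[where i = v]) auto
    then have s: "s > 0" "s\<^sup>2 = (\<Sum>v\<in>?V. (Z v)\<^sup>2)"
      by (simp_all add: s_def)
    have x0: "x v \<ge> 0" if "v \<in> ?V" for v
      using Z0[OF that] s(1) by (simp add: x_def)
    have x1: "(\<Sum>v\<in>?V. (x v)\<^sup>2) = 1"
      using s(1) by (simp add: x_def power_divide flip: sum_divide_distrib s(2))
    \<comment> \<open>The triangle inequality weakens the eigenvalue equation to an entrywise
      inequality for moduli; pairing it with \<open>x\<close> then bounds \<open>norm \<mu>\<close>
      by the quadratic form.\<close>
    have eig: "norm \<mu> * x v \<le> (\<Sum>u\<in>{u\<in>?V. (v, u) \<in> ?E}. x u)" if v: "v \<in> ?V" for v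
    proof -
      obtain i where i: "i < length vs" "v = vs ! i"
        using v vs(2) by (metis in_set_conv_nth)
      have "norm \<mu> * Z v = norm ((B *\<^sub>v z) $ i)"
        using i z Z by (simp add: n_def norm_mult)
      also have "\<dots> \<le> (\<Sum>u\<in>{u\<in>?V. (v, u) \<in> ?E}. Z u)"
        unfolding B_eq i(2) vs(2)[symmetric]
        by (rule norm_adjacency_mult_vec_le[OF vs(1) z(1)[unfolded n_def] Z i(1)])
      finally show ?thesis
        using s(1) by (simp add: x_def divide_right_mono flip: sum_divide_distrib)
    qed
    have "norm \<mu> = (\<Sum>v\<in>?V. x v * (norm \<mu> * x v))"
      using x1 by (simp add: power2_eq_square algebra_simps flip: sum_distrib_left)
    also have "\<dots> \<le> (\<Sum>v\<in>?V. x v * (\<Sum>u\<in>{u\<in>?V. (v, u) \<in> ?E}. x u))"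
      using x0 eig by (intro sum_mono mult_left_mono) auto
    finally have "norm \<mu> ^ (2 * t * (t - 1)) \<le> \<dots> ^ (2 * t * (t - 1))"
      by (rule power_mono) simp
    also have "\<dots> \<le> real (card ?E) ^ (t * (t - 2)) * real C"
      unfolding C by (rule quadratic_form_power_le[OF pair_finite_verts E card(1) assms(1) x0 x1])
    finally show ?thesis
      using M \<mu>(2) by (simp add: real_spectral_radius_def B_def M_eq_card_parcs[OF assms(2)]
          divide_le_eq mult.commute)
  qed
  ultimately show ?thesis
    by (simp add: C_def)
qed

end
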